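(* Let $J,R,Q\in\mathbb R^{n\times n}$, $B\in\mathbb R^{n\times m}$ with $J^\top=-J$, $R=R^\top\succeq0$, $Q=Q^\top\succ0$ define a port-Hamiltonian system with $A=(J-R)Q$, $C=B^\top Q$ that is minimal ($(A,B)$ controllable, $(A,C)$ observable). Let $(\widehat A_r,\widehat B_r,\widehat C_r)$ be the reduced-order model of order $r<n$ obtained by balancing the system with respect to $\widehat{\mathcal P}_{\mathrm c}$ and $\widehat{\mathcal P}_{\mathrm f}$ followed by the effort-constraint reduction method (procedure described in the context). Then $(\widehat A_r,\widehat B_r,\widehat C_r)$ has a port-Hamiltonian realization. Moreover, $(\widehat A_r,\widehat B_r,\widehat C_r)$ can be obtained by simple truncation of a system that is balanced with respect to $\widehat{\mathcal P}_{\mathrm c}$ and $\widehat{\mathcal P}_{\mathrm f}$; i.e., writing the balanced system $A_{\mathrm b}=(J_{\mathrm b}-R_{\mathrm b})Q_{\mathrm b}$, $B_{\mathrm b}$, $C_{\mathrm b}=B_{\mathrm b}^\top Q_{\mathrm b}$ in block form with leading blocks of size $r$, $A_{\mathrm b}=\begin{bmatrix} A_{11} & A_{12} \\ A_{21} & A_{22} \end{bmatrix}$, $B_{\mathrm b}=\begin{bmatrix} B_1 \\ B_2 \end{bmatrix}$, $C_{\mathrm b}=\begin{bmatrix} C_1 & C_2 \end{bmatrix}$, one has $(\widehat A_r,\widehat B_r,\widehat C_r)=(A_{11},B_1,C_1)$.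
   Context: A linear system $\dot x=\mathcal Ax+\mathcal Bu$, $y=\mathcal Cx$ is port-Hamiltonian if there are $\mathcal J=-\mathcal J^\top$, $\mathcal R=\mathcal R^\top\succeq0$, $\mathcal Q=\mathcal Q^\top\succ0$ with $\mathcal A=(\mathcal J-\mathcal R)\mathcal Q$, $\mathcal C=\mathcal B^\top\mathcal Q$. $\widehat{\mathcal P}_{\mathrm c}$ and $\widehat{\mathcal P}_{\mathrm f}$ are the unique stabilizing solutions of $A^\top\widehat{\mathcal P}_{\mathrm c}+\widehat{\mathcal P}_{\mathrm c}A-\widehat{\mathcal P}_{\mathrm c}BB^\top\widehat{\mathcal P}_{\mathrm c}+C^\top C=0$ and $A\widehat{\mathcal P}_{\mathrm f}+\widehat{\mathcal P}_{\mathrm f}A^\top-\widehat{\mathcal P}_{\mathrm f}C^\top C\widehat{\mathcal P}_{\mathrm f}+BB^\top+2R=0$ (stabilizing: $A-BB^\top\widehat{\mathcal P}_{\mathrm c}$, respectively $A-\widehat{\mathcal P}_{\mathrm f}C^\top C$, has all eigenvalues in the open left half plane). Reduction procedure: (1) compute $\widehat{\mathcal P}_{\mathrm c},\widehat{\mathcal P}_{\mathrm f}$; (2) choose an invertible $T\in\mathbb R^{n\times n}$ with $T\widehat{\mathcal P}_{\mathrm f}T^\top=T^{-\top}\widehat{\mathcal P}_{\mathrm c}T^{-1}=\mathrm{diag}(\sigma_1,\dots,\sigma_n)$; (3) form the balanced system $J_{\mathrm b}=TJT^\top$, $R_{\mathrm b}=TRT^\top$, $Q_{\mathrm b}=T^{-\top}QT^{-1}$,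 $B_{\mathrm b}=TB$; (4) apply the effort-constraint method: partition $J_{\mathrm b}=\begin{bmatrix} J_{11} & J_{12} \\ J_{21} & J_{22} \end{bmatrix}$, $R_{\mathrm b}=\begin{bmatrix} R_{11} & R_{12} \\ R_{21} & R_{22} \end{bmatrix}$, $Q_{\mathrm b}=\begin{bmatrix} Q_{11} & Q_{12} \\ Q_{21} & Q_{22} \end{bmatrix}$, $B_{\mathrm b}=\begin{bmatrix} B_1 \\ B_2 \end{bmatrix}$ with leading blocks of size $r$, and set $\widehat J_r=J_{11}$, $\widehat R_r=R_{11}$, $\widehat Q_r=Q_{11}-Q_{12}Q_{22}^{-1}Q_{21}$, $\widehat B_r=B_1$, $\widehat A_r=(\widehat J_r-\widehat R_r)\widehat Q_r$, $\widehat C_r=\widehat B_r^\top\widehat Q_r$. *)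

theory Defs
  imports
    Complex_Main
    "Jordan_Normal_Form.Matrix"
    "Jordan_Normal_Form.Char_Poly"
    "Jordan_Normal_Form.Gauss_Jordan_Elimination"
    "Jordan_Normal_Form.DL_Rank"
begin

definition pos_semidef :: "nat \<Rightarrow> real mat \<Rightarrow> bool" where
  "pos_semidef n M \<longleftrightarrow> M \<in> carrier_mat n n \<and> transpose_mat M = M \<and>
     (\<forall>v \<in> carrier_vec n. v \<bullet> (M *\<^sub>v v) \<ge> 0)"

definition pos_def :: "nat \<Rightarrow> real mat \<Rightarrow> bool" where
  "pos_def n M \<longleftrightarrow> M \<in> carrier_mat n n \<and> transpose_mat M = M \<and>
     (\<forall>v \<in> carrier_vec n. v \<noteq> 0\<^sub>v n \<longrightarrow> v \<bullet> (M *\<^sub>v v) > 0)"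

definition skew_symmetric :: "nat \<Rightarrow> real mat \<Rightarrow> bool" where
  "skew_symmetric n M \<longleftrightarrow> M \<in> carrier_mat n n \<and> transpose_mat M = - M"

text \<open>A system is given by its matrices \<open>A\<close>, \<open>B\<close>, \<open>C\<close>, with state dimension \<open>n\<close> and \<open>m\<close>
  inputs and outputs.\<close>

definition port_hamiltonian :: "nat \<Rightarrow> nat \<Rightarrow> real mat \<times> real mat \<times> real mat \<Rightarrow> bool" where
  "port_hamiltonian n m = (\<lambda>(A, B, C). B \<in> carrier_mat n m \<and>
     (\<exists>J R Q. skew_symmetric n J \<and> pos_semidef n R \<and> pos_def n Q \<and>
        A = (J - R) * Q \<and> C = transpose_mat B * Q))"

text \<open>The matrix \<open>[B, A B, \<dots>, A\<^sup>n\<^sup>-\<^sup>1 B]\<close> and the matrix with block rows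
  \<open>C, C A, \<dots>, C A\<^sup>n\<^sup>-\<^sup>1\<close>.\<close>

definition controllability_matrix :: "nat \<Rightarrow> nat \<Rightarrow> real mat \<Rightarrow> real mat \<Rightarrow> real mat" where
  "controllability_matrix n m A B =
     mat n (n * m) (\<lambda>(i, j). ((A ^\<^sub>m (j div m)) * B) $$ (i, j mod m))"

definition observability_matrix :: "nat \<Rightarrow> nat \<Rightarrow> real mat \<Rightarrow> real mat \<Rightarrow> real mat" where
  "observability_matrix n m A C =
     mat (n * m) n (\<lambda>(i, j). (C * (A ^\<^sub>m (i div m))) $$ (i mod m, j))"

definition controllable :: "nat \<Rightarrow> nat \<Rightarrow> real mat \<Rightarrow> real mat \<Rightarrow> bool" where
  "controllable n m A B \<longleftrightarrow> vec_space.rank n (controllability_matrix n m A B) = n"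

definition observable :: "nat \<Rightarrow> nat \<Rightarrow> real mat \<Rightarrow> real mat \<Rightarrow> bool" where
  "observable n m A C \<longleftrightarrow> vec_space.rank (n * m) (observability_matrix n m A C) = n"

definition hurwitz :: "real mat \<Rightarrow> bool" where
  "hurwitz M \<longleftrightarrow> (\<forall>k. eigenvalue (map_mat complex_of_real M) k \<longrightarrow> Re k < 0)"

definition stabilizing_control ::
  "nat \<Rightarrow> real mat \<Rightarrow> real mat \<Rightarrow> real mat \<Rightarrow> real mat \<Rightarrow> bool" where
  "stabilizing_control n A B C P \<longleftrightarrow> P \<in> carrier_mat n n \<and>
     transpose_mat A * P + P * A - P * B * transpose_mat B * P + transpose_mat C * C = 0\<^sub>m n n \<and>
     hurwitz (A - B * transpose_mat B * P)"

definition stabilizing_filter ::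
  "nat \<Rightarrow> real mat \<Rightarrow> real mat \<Rightarrow> real mat \<Rightarrow> real mat \<Rightarrow> real mat \<Rightarrow> bool" where
  "stabilizing_filter n A B C R P \<longleftrightarrow> P \<in> carrier_mat n n \<and>
     A * P + P * transpose_mat A - P * transpose_mat C * C * P + B * transpose_mat B
       + 2 \<cdot>\<^sub>m R = 0\<^sub>m n n \<and>
     hurwitz (A - P * transpose_mat C * C)"

text \<open>Only meaningful for invertible matrices.\<close>

definition inv_mat :: "real mat \<Rightarrow> real mat" where
  "inv_mat M = the (mat_inverse M)"

definition balancing :: "nat \<Rightarrow> real mat \<Rightarrow> real mat \<Rightarrow> real mat \<Rightarrow> bool" where
  "balancing n Pc Pf T \<longleftrightarrow> T \<in> carrier_mat n n \<and> invertible_mat T \<and>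
     (\<exists>\<sigma>. T * Pf * transpose_mat T = mat_diag n \<sigma> \<and>
          transpose_mat (inv_mat T) * Pc * inv_mat T = mat_diag n \<sigma>)"

definition effort_constraint ::
  "nat \<Rightarrow> real mat \<Rightarrow> real mat \<Rightarrow> real mat \<Rightarrow> real mat \<Rightarrow> real mat \<times> real mat \<times> real mat" where
  "effort_constraint r J R Q B =
     (let (J11, J12, J21, J22) = split_block J r r;
          (R11, R12, R21, R22) = split_block R r r;
          (Q11, Q12, Q21, Q22) = split_block Q r r;
          B1 = fst (split_block B r (dim_col B));
          Qr = Q11 - Q12 * inv_mat Q22 * Q21
      in ((J11 - R11) * Qr, B1, transpose_mat B1 * Qr))"

definition truncation ::
  "nat \<Rightarrow> real mat \<times> real mat \<times> real mat \<Rightarrow> real mat \<times> real mat \<times> real mat" where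
  "truncation r = (\<lambda>(A, B, C).
     (fst (split_block A r r), fst (split_block B r (dim_col B)), fst (split_block C (dim_row C) r)))"

end

theory Submission
  imports Defs "Jordan_Normal_Form.Schur_Decomposition"
begin

text \<open>The matrix \<open>Q\<^sup>-\<^sup>1\<close> solves the filter equation: its closed-loop matrix is
  \<open>(J - R - B B\<^sup>T) Q\<close>, whose spectrum lies in the closed left half plane. The difference of
  \<open>Q\<^sup>-\<^sup>1\<close> and the stabilizing solution \<open>P\<^sub>f\<close> solves a homogeneous Sylvester equation
  whose two coefficients have disjoint spectra, so \<open>P\<^sub>f = Q\<^sup>-\<^sup>1\<close>. Hence balancing turns
  \<open>Q\<^sub>b\<close> into the inverse of the diagonal matrix \<open>T P\<^sub>f T\<^sup>T\<close>: the off-diagonal blocks of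
  \<open>Q\<^sub>b\<close> vanish, the Schur complement of the effort-constraint method is the leading block
  of \<open>Q\<^sub>b\<close>, and the reduced model is both a truncation and port-Hamiltonian.\<close>

section \<open>Inverses and nonzero determinants\<close>

text \<open>A nonzero determinant makes \<open>M\<close> a unit of the matrix ring, so
  \<open>mat_inverse\<close> returns \<open>Some\<close> and the \<open>the\<close> in
  \<open>inv_mat\<close> is well defined.\<close>

lemma inv_mat:
  assumes M: "M \<in> carrier_mat n n" and d: "det M \<noteq> 0"
  shows "inv_mat M \<in> carrier_mat n n" "M * inv_mat M = 1\<^sub>m n" "inv_mat M * M = 1\<^sub>m n"
proof -
  have "M \<in> Units (ring_mat TYPE(real) n ())"
    by (rule det_non_zero_imp_unit[OF M d])
  then obtain N where N: "mat_inverse M = Some N"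
    using mat_inverse(1)[OF M, where b = "()"] by (cases "mat_inverse M") blast+
  with mat_inverse(2)[OF M N] show "inv_mat M \<in> carrier_mat n n" "M * inv_mat M = 1\<^sub>m n"
    "inv_mat M * M = 1\<^sub>m n" by (auto simp: inv_mat_def)
qed

lemma invertible_mat_det_nonzero:
  fixes M :: "'a :: field mat"
  assumes M: "M \<in> carrier_mat n n" and inv: "invertible_mat M"
  shows "det M \<noteq> 0"
proof -
  obtain N where MN: "M * N = 1\<^sub>m n" and NM: "N * M = 1\<^sub>m (dim_row N)"
    using inv M by (auto simp: invertible_mat_def inverts_mat_def)
  \<comment> \<open>\<open>invertible_mat\<close> does not fix the size of the inverse; comparing
    column counts in both products recovers it.\<close>
  have "dim_col N = n" "dim_row N = n"
    using arg_cong[OF MN, of dim_col] arg_cong[OF NM, of dim_col] M by auto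
  then have N: "N \<in> carrier_mat n n" by blast
  from det_mult[OF M N] MN show ?thesis by auto
qed

lemma pos_def_det_nonzero:
  assumes "pos_def n M"
  shows "det M \<noteq> 0"
proof
  assume "det M = 0"
  then obtain v where v: "v \<in> carrier_vec n" "v \<noteq> 0\<^sub>v n" "M *\<^sub>v v = 0\<^sub>v n"
    using assms det_0_iff_vec_prod_zero[of M n] by (auto simp: pos_def_def)
  moreover have "0 < v \<bullet> (M *\<^sub>v v)" using v(1,2) assms unfolding pos_def_def by blast
  ultimately show False by simp
qed

section \<open>Congruence transformations\<close>

text \<open>The matrix \<open>S\<close> may be rectangular here and in the lemmas below, so that
  they serve both the change of coordinates and the compression to a leading block.\<close>

lemma transpose_congruence:
  fixes M :: "'a :: comm_semiring_1 mat"
  assumes M: "M \<in> carrier_mat n n" and S: "S \<in> carrier_mat k n"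
  shows "transpose_mat (S * M * transpose_mat S) = S * transpose_mat M * transpose_mat S"
proof -
  have "transpose_mat (S * M * transpose_mat S) = S * transpose_mat (S * M)"
    using transpose_mult[of "S * M" k n "transpose_mat S" k] M S by simp
  also have "\<dots> = S * (transpose_mat M * transpose_mat S)"
    using transpose_mult[OF S M] by simp
  also have "\<dots> = S * transpose_mat M * transpose_mat S"
    using M S by (simp add: assoc_mult_mat[of _ k n _ n _ k])
  finally show ?thesis .
qed

lemma quadratic_form_congruence:
  fixes M :: "'a :: comm_semiring_1 mat"
  assumes M: "M \<in> carrier_mat n n" and S: "S \<in> carrier_mat k n" and v: "v \<in> carrier_vec k"
  shows "v \<bullet> (S * M * transpose_mat S *\<^sub>v v)
    = (transpose_mat S *\<^sub>v v) \<bullet> (M *\<^sub>v (transpose_mat S *\<^sub>v v))"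
proof -
  let ?w = "transpose_mat S *\<^sub>v v"
  have S': "transpose_mat S \<in> carrier_mat n k" using S by simp
  have w: "?w \<in> carrier_vec n" using S' v by simp
  have "S * M * transpose_mat S *\<^sub>v v = S *\<^sub>v (M *\<^sub>v ?w)"
    using M S v by (simp add: assoc_mult_mat_vec[of _ k n _ k] assoc_mult_mat_vec[of _ k n _ n])
  moreover have "?w \<bullet> (M *\<^sub>v ?w) = v \<bullet> (S *\<^sub>v (M *\<^sub>v ?w))"
    using transpose_vec_mult_scalar[of "transpose_mat S" n k v "M *\<^sub>v ?w"] M S v w
      comm_scalar_prod[of "M *\<^sub>v ?w" n ?w] comm_scalar_prod[of "S *\<^sub>v (M *\<^sub>v ?w)" k v] by simp
  ultimately show ?thesis by simp
qed

lemma skew_symmetric_congruence: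
  assumes "skew_symmetric n M" and S: "S \<in> carrier_mat k n"
  shows "skew_symmetric k (S * M * transpose_mat S)"
proof -
  have M: "M \<in> carrier_mat n n" "transpose_mat M = - M"
    using assms by (auto simp: skew_symmetric_def)
  have "S * (- M) * transpose_mat S = - (S * M * transpose_mat S)"
    using M S uminus_mult_left_mat[of "S * M" "transpose_mat S"]
      uminus_mult_right_mat[of S M] by simp
  then show ?thesis
    using transpose_congruence[OF M(1) S] M S by (simp add: skew_symmetric_def)
qed

lemma pos_semidef_congruence:
  assumes "pos_semidef n M" and S: "S \<in> carrier_mat k n"
  shows "pos_semidef k (S * M * transpose_mat S)"
  using assms transpose_congruence[of M n S k]
  by (auto simp: pos_semidef_def quadratic_form_congruence[of _ n])

text \<open>The quadratic form is evaluated at \<open>transpose_mat S *\<^sub>v v\<close>;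
  injectivity keeps this vector nonzero, hence the form strictly positive.\<close>

lemma pos_def_congruence:
  assumes "pos_def n M" and S: "S \<in> carrier_mat k n"
    and inj: "\<And>v. v \<in> carrier_vec k \<Longrightarrow> transpose_mat S *\<^sub>v v = 0\<^sub>v n \<Longrightarrow> v = 0\<^sub>v k"
  shows "pos_def k (S * M * transpose_mat S)"
  unfolding pos_def_def
proof (intro conjI ballI impI)
  have M: "M \<in> carrier_mat n n" "transpose_mat M = M" using assms(1) by (auto simp: pos_def_def)
  show "S * M * transpose_mat S \<in> carrier_mat k k"
    "transpose_mat (S * M * transpose_mat S) = S * M * transpose_mat S"
    using M S transpose_congruence[OF M(1) S] by auto
  fix v :: "real vec" assume v: "v \<in> carrier_vec k" "v \<noteq> 0\<^sub>v k"
  then have "transpose_mat S *\<^sub>v v \<noteq> 0\<^sub>v n" using inj by blast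
  moreover have "transpose_mat S *\<^sub>v v \<in> carrier_vec n" using S v by simp
  ultimately show "v \<bullet> (S * M * transpose_mat S *\<^sub>v v) > 0"
    unfolding quadratic_form_congruence[OF M(1) S v(1)]
    using assms(1) unfolding pos_def_def by blast
qed

text \<open>Transposing \<open>S * N = 1\<close> gives a left inverse of the transpose of
  \<open>S\<close>, which is therefore injective.\<close>

lemma pos_def_congruence_right_inverse:
  assumes "pos_def n M" and S: "S \<in> carrier_mat k n" and N: "N \<in> carrier_mat n k"
    and SN: "S * N = 1\<^sub>m k"
  shows "pos_def k (S * M * transpose_mat S)"
proof (rule pos_def_congruence[OF assms(1) S])
  fix v :: "real vec" assume v: "v \<in> carrier_vec k" and z: "transpose_mat S *\<^sub>v v = 0\<^sub>v n"
  have "transpose_mat N * transpose_mat S = 1\<^sub>m k"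
    using transpose_mult[OF S N] SN by simp
  then have "v = transpose_mat N *\<^sub>v (transpose_mat S *\<^sub>v v)"
    using v S N assoc_mult_mat_vec[of "transpose_mat N" k n "transpose_mat S" k v] by simp
  then show "v = 0\<^sub>v k" using z N by auto
qed

section \<open>Uniqueness of the stabilizing solution\<close>

text \<open>A Schur decomposition \<open>N = P U P'\<close> turns the equation into
  \<open>M F = F U\<close> with \<open>F = D P\<close> and \<open>U\<close> upper triangular. The
  first nonzero column of \<open>F\<close> would be an eigenvector of \<open>M\<close> for a
  diagonal entry of \<open>U\<close>, which is an eigenvalue of \<open>N\<close>.\<close>

lemma sylvester_homogeneous_zero:
  fixes M N D :: "complex mat"
  assumes M: "M \<in> carrier_mat k k" and N: "N \<in> carrier_mat n n" and D: "D \<in> carrier_mat k n"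
    and eq: "M * D = D * N"
    and disj: "\<And>e. eigenvalue M e \<Longrightarrow> eigenvalue N e \<Longrightarrow> False"
  shows "D = 0\<^sub>m k n"
proof -
  obtain es where es: "char_poly N = (\<Prod>a\<leftarrow>es. [:- a, 1:])"
    using char_poly_factorized[OF N] by blast
  obtain U P P' where dec: "schur_decomposition N es = (U, P, P')"
    by (metis prod_cases3)
  from schur_decomposition[OF N es dec] have sim: "similar_mat_wit N U P P'"
    and ut: "upper_triangular U" and diag: "diag_mat U = es" by auto
  from similar_mat_witD2[OF N sim] have PP: "P * P' = 1\<^sub>m n" "P' * P = 1\<^sub>m n" "N = P * U * P'"
    and U: "U \<in> carrier_mat n n" and P: "P \<in> carrier_mat n n" "P' \<in> carrier_mat n n" by auto
  define F where "F = D * P"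
  have F: "F \<in> carrier_mat k n" using D P by (simp add: F_def)
  have NP: "N * P = P * U"
    using PP P U by (simp add: assoc_mult_mat[of _ n n _ n _ n])
  have MF: "M * F = F * U"
  proof -
    have "M * F = (M * D) * P" using M D P by (simp add: F_def assoc_mult_mat[of _ k k _ n _ n])
    also have "\<dots> = D * (N * P)" using eq D N P by (simp add: assoc_mult_mat[of _ k n _ n _ n])
    also have "\<dots> = F * U" using NP D P U by (simp add: F_def assoc_mult_mat[of _ k n _ n _ n])
    finally show ?thesis .
  qed
  have cols: "j < n \<Longrightarrow> col F j = 0\<^sub>v k" for j
  proof (induction j rule: less_induct)
    case (less j)
    have "M *\<^sub>v col F j = col (F * U) j"
      using col_mult2[OF M F less.prems] MF by simp
    also have "\<dots> = U $$ (j, j) \<cdot>\<^sub>v col F j"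
    proof (rule eq_vecI)
      fix i assume "i < dim_vec (U $$ (j, j) \<cdot>\<^sub>v col F j)"
      then have i: "i < k" using F by simp
      \<comment> \<open>Only the diagonal term survives: columns before \<open>j\<close> vanish by
        induction, and entries of \<open>U\<close> below the diagonal vanish by
        triangularity.\<close>
      have z: "F $$ (i, l) * U $$ (l, j) = 0" if "l < n" "l \<noteq> j" for l
      proof (cases "l < j")
        case True
        then have "F $$ (i, l) = col F l $ i" using F i that by simp
        then show ?thesis using less.IH[OF True] that i by simp
      next
        case False
        then show ?thesis using ut U that by (auto simp: upper_triangular_def)
      qed
      have "col (F * U) j $ i = (\<Sum>l = 0..<n. F $$ (i, l) * U $$ (l, j))"
        using F U i less.prems by (simp add: scalar_prod_def)
      also have "\<dots> = F $$ (i, j) * U $$ (j, j)"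
        using z less.prems by (subst sum.remove[of _ j]) (auto intro!: sum.neutral simp del: mult_eq_0_iff)
      finally show "col (F * U) j $ i = (U $$ (j, j) \<cdot>\<^sub>v col F j) $ i"
        using F i less.prems by simp
    qed (use F U in simp)
    finally have ev: "M *\<^sub>v col F j = U $$ (j, j) \<cdot>\<^sub>v col F j" .
    have "U $$ (j, j) \<in> set es"
      using diag U less.prems by (auto simp: diag_mat_def)
    then have "eigenvalue N (U $$ (j, j))"
      using eigenvalue_root_char_poly[OF N] es by (auto simp: poly_prod_list prod_list_zero_iff)
    then have "\<not> eigenvalue M (U $$ (j, j))" using disj by blast
    moreover have "col F j \<in> carrier_vec k" using F by auto
    ultimately show ?case
      using ev M unfolding eigenvalue_def eigenvector_def by auto
  qed
  have "F = 0\<^sub>m k n"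
    by (rule mat_col_eqI) (use F cols in auto)
  then have "D * (P * P') = 0\<^sub>m k n"
    using D P assoc_mult_mat[OF D P] by (simp add: F_def)
  then show ?thesis using PP D by simp
qed

text \<open>Lyapunov: the hypothesis says that \<open>X N + N\<^sup>T X\<close> is positive semidefinite.\<close>

lemma eigenvalue_Re_nonneg:
  assumes X: "pos_def n X" and N: "N \<in> carrier_mat n n"
    and nn: "\<And>v. v \<in> carrier_vec n \<Longrightarrow> v \<bullet> (X * N *\<^sub>v v) \<ge> 0"
    and ev: "eigenvalue (map_mat complex_of_real N) e"
  shows "Re e \<ge> 0"
proof -
  obtain v where v: "v \<in> carrier_vec n" "v \<noteq> 0\<^sub>v n"
    and Nv: "map_mat complex_of_real N *\<^sub>v v = e \<cdot>\<^sub>v v"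
    using ev N unfolding eigenvalue_def eigenvector_def by auto
  have X': "X \<in> carrier_mat n n" "transpose_mat X = X" using X by (auto simp: pos_def_def)
  \<comment> \<open>The form is only known to be nonnegative on real vectors, so the complex
    eigenvector is split into real and imaginary parts.\<close>
  define a where "a = map_vec Re v"
  define b where "b = map_vec Im v"
  have ab: "a \<in> carrier_vec n" "b \<in> carrier_vec n" using v by (auto simp: a_def b_def)
  have comp: "(\<Sum>l = 0..<n. complex_of_real (N $$ (i, l)) * v $ l) = e * v $ i" if "i < n" for i
    using arg_cong[OF Nv, of "\<lambda>w. w $ i"] that N v by (simp add: scalar_prod_def)
  have Na: "N *\<^sub>v a = Re e \<cdot>\<^sub>v a + (- Im e) \<cdot>\<^sub>v b"
  proof (rule eq_vecI)
    fix i assume "i < dim_vec (Re e \<cdot>\<^sub>v a + (- Im e) \<cdot>\<^sub>v b)"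
    then have i: "i < n" using ab by simp
    show "(N *\<^sub>v a) $ i = (Re e \<cdot>\<^sub>v a + (- Im e) \<cdot>\<^sub>v b) $ i"
      using arg_cong[OF comp[OF i], of Re] i N v
      by (simp add: scalar_prod_def a_def b_def)
  qed (use N ab in auto)
  have Nb: "N *\<^sub>v b = Re e \<cdot>\<^sub>v b + Im e \<cdot>\<^sub>v a"
  proof (rule eq_vecI)
    fix i assume "i < dim_vec (Re e \<cdot>\<^sub>v b + Im e \<cdot>\<^sub>v a)"
    then have i: "i < n" using ab by simp
    show "(N *\<^sub>v b) $ i = (Re e \<cdot>\<^sub>v b + Im e \<cdot>\<^sub>v a) $ i"
      using arg_cong[OF comp[OF i], of Im] i N v
      by (simp add: scalar_prod_def a_def b_def)
  qed (use N ab in auto)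
  \<comment> \<open>Symmetry of \<open>X\<close> makes the mixed terms with factor
    \<open>Im e\<close> cancel when the forms at \<open>a\<close> and \<open>b\<close> are
    added.\<close>
  have sym: "b \<bullet> (X *\<^sub>v a) = a \<bullet> (X *\<^sub>v b)"
    using transpose_vec_mult_scalar[OF X'(1) ab(1) ab(2)] X' ab
      comm_scalar_prod[of "X *\<^sub>v b" n a] by simp
  have form: "u \<bullet> (X *\<^sub>v (s \<cdot>\<^sub>v u + t \<cdot>\<^sub>v w)) = s * (u \<bullet> (X *\<^sub>v u)) + t * (u \<bullet> (X *\<^sub>v w))"
    if "u \<in> carrier_vec n" "w \<in> carrier_vec n" for u w s t
    using that X' by (simp add: mult_add_distrib_mat_vec[of _ n n] mult_mat_vec[of _ n n]
        scalar_prod_add_distrib[of _ n])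
  have "0 \<le> a \<bullet> (X * N *\<^sub>v a) + b \<bullet> (X * N *\<^sub>v b)"
    using nn ab by (simp add: add_nonneg_nonneg)
  also have "\<dots> = Re e * (a \<bullet> (X *\<^sub>v a) + b \<bullet> (X *\<^sub>v b))"
    using ab X' N
    by (simp only: assoc_mult_mat_vec[of _ n n _ n] Na Nb form sym) (simp add: algebra_simps)
  finally have le: "0 \<le> Re e * (a \<bullet> (X *\<^sub>v a) + b \<bullet> (X *\<^sub>v b))" .
  have pos: "0 < w \<bullet> (X *\<^sub>v w)" if "w \<in> carrier_vec n" "w \<noteq> 0\<^sub>v n" for w
    using that X by (auto simp: pos_def_def)
  have zero: "w \<bullet> (X *\<^sub>v w) \<ge> 0" if "w \<in> carrier_vec n" for w
    using pos[OF that] that X' by (cases "w = 0\<^sub>v n") auto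
  have "a \<noteq> 0\<^sub>v n \<or> b \<noteq> 0\<^sub>v n"
  proof (rule ccontr)
    assume "\<not> ?thesis"
    then have "a $ i = 0" "b $ i = 0" if "i < n" for i
      using that by simp_all
    then have "v $ i = 0" if "i < n" for i
      using that v by (simp add: a_def b_def complex_eq_iff)
    then have "v = 0\<^sub>v n" using v by (intro eq_vecI) auto
    with v show False by simp
  qed
  then have "0 < a \<bullet> (X *\<^sub>v a) + b \<bullet> (X *\<^sub>v b)"
    using pos zero ab by (metis add_nonneg_pos add_pos_nonneg)
  with le show ?thesis by (simp add: zero_le_mult_iff)
qed

text \<open>With \<open>X = Q^-1\<close>, the difference \<open>P - X\<close> intertwines the
  closed-loop matrix \<open>F\<close> of \<open>P\<close> with a matrix \<open>N\<close>. The
  spectrum of \<open>F\<close> lies in the open left half plane and that of \<open>N\<close> in the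
  closed right one. The strict inequality on one side alone makes them disjoint.\<close>

lemma stabilizing_filter_eq_inverse:
  assumes J: "skew_symmetric n J" and R: "pos_semidef n R" and Q: "pos_def n Q"
    and B: "B \<in> carrier_mat n m"
    and filt: "stabilizing_filter n ((J - R) * Q) B (transpose_mat B * Q) R P"
  shows "P = inv_mat Q"
proof -
  define X where "X = inv_mat Q"
  define G where "G = B * transpose_mat B"
  have Jc: "J \<in> carrier_mat n n" "transpose_mat J = - J" using J by (auto simp: skew_symmetric_def)
  have Rc: "R \<in> carrier_mat n n" "transpose_mat R = R" using R by (auto simp: pos_semidef_def)
  have Qc: "Q \<in> carrier_mat n n" "transpose_mat Q = Q" using Q by (auto simp: pos_def_def)
  have Xc: "X \<in> carrier_mat n n" and QX: "Q * X = 1\<^sub>m n" and XQ: "X * Q = 1\<^sub>m n"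
    using inv_mat[OF Qc(1) pos_def_det_nonzero[OF Q]] by (auto simp: X_def)
  have Gc: "G \<in> carrier_mat n n" using B by (simp add: G_def)
  have Pc: "P \<in> carrier_mat n n" using filt by (simp add: stabilizing_filter_def)
  define Y where "Y = J + R + G"
  \<comment> \<open>\<open>N\<close> is minus the transpose of \<open>(J - R - G) * Q\<close>, the
    closed-loop matrix belonging to \<open>X\<close>.\<close>
  define N where "N = Q * Y"
  have Yc: "Y \<in> carrier_mat n n" using Jc Rc Gc by (simp add: Y_def)
  have Nc: "N \<in> carrier_mat n n" using Qc Yc by (simp add: N_def)
  have XN: "X * N = Y" using XQ Xc Qc Yc
    by (simp add: N_def assoc_mult_mat[of _ n n _ n _ n, symmetric])
  have XT: "transpose_mat X = X"
  proof -
    have "transpose_mat X * Q = 1\<^sub>m n" using transpose_mult[OF Qc(1) Xc] QX Qc by simp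
    then have "transpose_mat X * (Q * X) = X"
      using Xc Qc by (simp add: assoc_mult_mat[of _ n n _ n _ n, symmetric])
    then show ?thesis using QX Xc by simp
  qed
  \<comment> \<open>\<open>X\<close> is itself a congruence of \<open>Q\<close>, namely
    \<open>X * Q * transpose_mat X\<close>.\<close>
  have Xpd: "pos_def n X"
    using pos_def_congruence_right_inverse[OF Q Xc Qc(1) XQ] XT XQ Xc by simp
  have Jform: "v \<bullet> (J *\<^sub>v v) = 0" if v: "v \<in> carrier_vec n" for v
  proof -
    have "v \<bullet> (J *\<^sub>v v) = (transpose_mat J *\<^sub>v v) \<bullet> v"
      using transpose_vec_mult_scalar[OF Jc(1) v v] by simp
    also have "\<dots> = - ((J *\<^sub>v v) \<bullet> v)"
      unfolding Jc(2) using Jc(1) v by (simp add: scalar_prod_def sum_negf)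
    also have "\<dots> = - (v \<bullet> (J *\<^sub>v v))" using Jc v comm_scalar_prod[of v n "J *\<^sub>v v"] by simp
    finally show ?thesis by simp
  qed
  have Gform: "v \<bullet> (G *\<^sub>v v) \<ge> 0" if v: "v \<in> carrier_vec n" for v
  proof -
    have "v \<bullet> (G *\<^sub>v v) = (transpose_mat B *\<^sub>v v) \<bullet> (transpose_mat B *\<^sub>v v)"
      using quadratic_form_congruence[of "1\<^sub>m m" m B n v] B v by (simp add: G_def)
    then show ?thesis by (simp add: scalar_prod_def sum_nonneg)
  qed
  \<comment> \<open>Since \<open>X * N = J + R + G\<close>, the skew part contributes zero and the
    other two are nonnegative.\<close>
  have form: "v \<bullet> (X * N *\<^sub>v v) \<ge> 0" if v: "v \<in> carrier_vec n" for v
  proof -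
    have "v \<bullet> (R *\<^sub>v v) \<ge> 0" using R v by (auto simp: pos_semidef_def)
    moreover have "v \<bullet> (Y *\<^sub>v v) = v \<bullet> (J *\<^sub>v v) + v \<bullet> (R *\<^sub>v v) + v \<bullet> (G *\<^sub>v v)"
      using Jc Rc Gc v by (simp add: Y_def add_mult_distrib_mat_vec[of _ n n] scalar_prod_add_distrib[of _ n])
    ultimately show ?thesis using Jform[OF v] Gform[OF v] XN by simp
  qed

  \<comment> \<open>The Riccati equation as a homogeneous Sylvester equation\<close>
  define A where "A = (J - R) * Q"
  define C where "C = transpose_mat B * Q"
  define F where "F = A - P * transpose_mat C * C"
  have Ac: "A \<in> carrier_mat n n" unfolding A_def using Jc Rc Qc
    by (intro mult_carrier_mat[of _ n n] minus_carrier_mat)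
  have PCC: "P * transpose_mat C * C = P * (Q * G * Q)"
    using B Qc Pc transpose_mult[of "transpose_mat B" m n Q n]
    by (simp add: C_def G_def assoc_mult_mat[of _ n n _ n _ n] assoc_mult_mat[of _ n n _ m _ n]
        assoc_mult_mat[of _ n m _ n _ n] assoc_mult_mat[of _ n n _ n _ m])
  define S where "S = P * (Q * G * Q)"
  have Sc: "S \<in> carrier_mat n n" using Pc Qc Gc by (simp add: S_def)
  have Fd: "F = A - S" and Fc: "F \<in> carrier_mat n n"
    using PCC Ac Sc by (simp_all add: F_def S_def[symmetric] minus_carrier_mat)
  have ric: "A * P + P * transpose_mat A - S * P + G + 2 \<cdot>\<^sub>m R = 0\<^sub>m n n"
    using filt PCC by (simp add: stabilizing_filter_def A_def[symmetric] C_def[symmetric]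
        G_def[symmetric] S_def[symmetric])
  have AT: "transpose_mat A = - (Q * (J + R))"
  proof -
    have "transpose_mat (J - R) = - (J + R)"
      using Jc Rc transpose_minus[OF Jc(1) Rc(1)] by (intro eq_matI) auto
    then show ?thesis
      using transpose_mult[of "J - R" n n Q n] Jc Rc Qc
      by (simp add: A_def minus_carrier_mat uminus_mult_right_mat)
  qed
  define H where "H = P * (Q * (J + R))"
  define K where "K = P * (Q * G)"
  have Hc: "H \<in> carrier_mat n n" using Pc Qc Jc Rc by (simp add: H_def)
  have Kc: "K \<in> carrier_mat n n" using Pc Qc Gc by (simp add: K_def)
  have PAT: "P * transpose_mat A = - H"
    using AT Pc Qc Jc Rc by (simp add: H_def uminus_mult_right_mat)
  have FP: "F * P = A * P - S * P"
    using Fd Ac Sc Pc by (simp add: minus_mult_distrib_mat)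
  have FX: "F * X = (J - R) - K"
  proof -
    have "A * X = J - R" using QX Jc Rc Qc Xc
      by (simp add: A_def assoc_mult_mat[of _ n n _ n _ n] minus_carrier_mat)
    moreover have "S * X = K" using QX Pc Gc Qc Xc
      by (simp add: S_def K_def assoc_mult_mat[of _ n n _ n _ n])
    ultimately show ?thesis using Fd Ac Sc Xc by (simp add: minus_mult_distrib_mat)
  qed
  have PN: "P * N = H + K"
  proof -
    have JR: "J + R \<in> carrier_mat n n" using Jc Rc by simp
    have "Q * Y = Q * (J + R) + Q * G"
      unfolding Y_def by (rule mult_add_distrib_mat[OF Qc(1) JR Gc])
    then show ?thesis
      using mult_add_distrib_mat[OF Pc mult_carrier_mat[OF Qc(1) JR] mult_carrier_mat[OF Qc(1) Gc]]
      by (simp add: N_def H_def K_def)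
  qed
  have key: "F * (P - X) = (P - X) * N"
  proof -
    have "F * (P - X) = (A * P - S * P) - ((J - R) - K)"
      using FP FX Fc Pc Xc by (simp add: mult_minus_distrib_mat)
    \<comment> \<open>The terms in \<open>J\<close> and \<open>K\<close> cancel, and the difference
      of the two sides is \<open>A P - H - S P + G + 2 R\<close>. This is the Riccati expression,
      because \<open>P\<close> times the transpose of \<open>A\<close> is \<open>- H\<close>. Matrix
      products stay unexpanded, so the check is linear in their entries.\<close>
    also have "\<dots> = (H + K) - Y"
    proof (rule eq_matI)
      fix i j assume "i < dim_row (H + K - Y)" "j < dim_col (H + K - Y)"
      then have ij: "i < n" "j < n" using Yc by auto
      show "((A * P - S * P) - ((J - R) - K)) $$ (i, j) = (H + K - Y) $$ (i, j)"
        using arg_cong[OF ric, of "\<lambda>M. M $$ (i, j)"] ij Ac Pc Sc Hc Kc Jc(1) Rc(1) Gc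
        unfolding PAT Y_def by (simp del: index_mult_mat(1))
    qed (use Yc Hc Kc Jc Rc in auto)
    also have "\<dots> = (P - X) * N"
      using PN XN Pc Xc Nc by (simp add: minus_mult_distrib_mat)
    finally show ?thesis .
  qed
  let ?c = "map_mat complex_of_real"
  have zero: "?c (P - X) = 0\<^sub>m n n"
  proof (rule sylvester_homogeneous_zero)
    show "?c F * ?c (P - X) = ?c (P - X) * ?c N"
      using arg_cong[OF key, of ?c] Fc Pc Xc Nc
      by (simp add: of_real_hom.mat_hom_mult[of _ n n _ n] minus_carrier_mat)
    fix e assume "eigenvalue (?c F) e" "eigenvalue (?c N) e"
    then have "Re e < 0" "Re e \<ge> 0"
      using filt eigenvalue_Re_nonneg[OF Xpd Nc form]
      by (auto simp: stabilizing_filter_def hurwitz_def F_def A_def C_def)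
    then show False by simp
  qed (use Fc Pc Xc Nc in \<open>auto simp: minus_carrier_mat\<close>)
  have "P = X"
  proof (rule eq_matI)
    fix i j assume "i < dim_row X" "j < dim_col X"
    then show "P $$ (i, j) = X $$ (i, j)"
      using arg_cong[OF zero, of "\<lambda>M. M $$ (i, j)"] Pc Xc
      by (simp flip: of_real_diff)
  qed (use Pc Xc in auto)
  then show ?thesis by (simp add: X_def)
qed

section \<open>Leading blocks\<close>

text \<open>For \<open>r \<le> n\<close> this is the block row \<open>[I 0]\<close>. It turns the
  selection of leading rows and columns into multiplication, and the leading block into a
  congruence.\<close>

definition lead :: "nat \<Rightarrow> nat \<Rightarrow> real mat" where
  "lead r n = mat r n (\<lambda>(i, j). if i = j then 1 else 0)"

lemma lead_carrier [simp]: "lead r n \<in> carrier_mat r n" "dim_row (lead r n) = r" "dim_col (lead r n) = n"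
  by (auto simp: lead_def)

lemma lead_mult:
  assumes M: "M \<in> carrier_mat n k" and r: "r \<le> n"
  shows "lead r n * M = mat r k (\<lambda>ij. M $$ ij)"
proof (rule eq_matI)
  fix i j assume "i < dim_row (mat r k (\<lambda>ij. M $$ ij))" "j < dim_col (mat r k (\<lambda>ij. M $$ ij))"
  then have ij: "i < r" "j < k" by auto
  have "(lead r n * M) $$ (i, j) = (\<Sum>l = 0..<n. (if i = l then 1 else 0) * M $$ (l, j))"
    using ij M r by (simp add: scalar_prod_def lead_def)
  also have "\<dots> = M $$ (i, j)"
    using ij r by (subst sum.remove[of _ i]) auto
  finally show "(lead r n * M) $$ (i, j) = mat r k (\<lambda>ij. M $$ ij) $$ (i, j)" using ij by simp
qed (use M in auto)

lemma mult_lead: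
  assumes M: "M \<in> carrier_mat k n" and r: "r \<le> n"
  shows "M * transpose_mat (lead r n) = mat k r (\<lambda>ij. M $$ ij)"
proof -
  have "transpose_mat (M * transpose_mat (lead r n)) = lead r n * transpose_mat M"
    using transpose_mult[of M k n "transpose_mat (lead r n)" r] M by simp
  also have "\<dots> = mat r k (\<lambda>ij. transpose_mat M $$ ij)"
    using lead_mult[of "transpose_mat M" n k r] M r by simp
  also have "\<dots> = transpose_mat (mat k r (\<lambda>ij. M $$ ij))"
    using M r by (intro eq_matI) auto
  finally show ?thesis by simp
qed

lemma lead_congruence:
  assumes M: "M \<in> carrier_mat n n" and r: "r \<le> n"
  shows "lead r n * M * transpose_mat (lead r n) = mat r r (\<lambda>ij. M $$ ij)"
  using mult_lead[of "lead r n * M" r n r] lead_mult[OF M r] M r by (auto intro!: eq_matI)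

lemma truncation_lead:
  assumes "A \<in> carrier_mat n n" "B \<in> carrier_mat n m" "C \<in> carrier_mat m n" "r \<le> n"
  shows "truncation r (A, B, C)
    = (lead r n * A * transpose_mat (lead r n), lead r n * B, C * transpose_mat (lead r n))"
  using assms lead_congruence[of A n r] lead_mult[of B n m r] mult_lead[of C m n r]
  by (simp add: truncation_def split_block_def Let_def)

text \<open>The off-diagonal blocks of a diagonal \<open>Q\<close> vanish, so the Schur complement
  is just its leading block.\<close>

lemma effort_constraint_diagonal:
  assumes J: "J \<in> carrier_mat n n" and R: "R \<in> carrier_mat n n" and Q: "Q \<in> carrier_mat n n"
    and B: "B \<in> carrier_mat n m" and r: "r \<le> n" and diag: "diagonal_mat Q"
  shows "effort_constraint r J R Q B =
    (let L = lead r n; Q' = L * Q * transpose_mat L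
     in ((L * J * transpose_mat L - L * R * transpose_mat L) * Q', L * B, transpose_mat (L * B) * Q'))"
proof -
  let ?Q12 = "mat r (n - r) (\<lambda>(i, j). Q $$ (i, j + r))"
  let ?Q21 = "mat (n - r) r (\<lambda>(i, j). Q $$ (i + r, j))"
  have Q21: "?Q21 = 0\<^sub>m (n - r) r"
    using diag Q by (intro eq_matI) (auto simp: diagonal_mat_def)
  \<comment> \<open>\<open>Z\<close> stands for the inverse of the trailing block; the zero factor
    annihilates the product for every value of it.\<close>
  have "?Q12 * Z * ?Q21 = 0\<^sub>m r r" for Z :: "real mat"
    unfolding Q21 by (rule eq_matI) (auto simp: scalar_prod_def)
  then have "mat r r (\<lambda>ij. Q $$ ij) - ?Q12 * Z * ?Q21 = mat r r (\<lambda>ij. Q $$ ij)" for Z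
    by (auto intro!: eq_matI)
  then show ?thesis
    using J R Q B r lead_congruence[OF J r] lead_congruence[OF R r] lead_congruence[OF Q r]
      lead_mult[OF B r]
    by (simp add: effort_constraint_def split_block_def Let_def)
qed

text \<open>The first \<open>r\<close> columns of a diagonal matrix vanish below row
  \<open>r\<close>, so padding their leading block with zero rows gives them back. This is what lets
  truncation pass through the factor \<open>Qb\<close>.\<close>

lemma diagonal_mult_lead:
  assumes Q: "Q \<in> carrier_mat n n" and r: "r \<le> n" and diag: "diagonal_mat Q"
  shows "Q * transpose_mat (lead r n)
    = transpose_mat (lead r n) * (lead r n * Q * transpose_mat (lead r n))"
proof (rule eq_matI)
  let ?L = "lead r n"
  fix i j
  assume "i < dim_row (transpose_mat ?L * (?L * Q * transpose_mat ?L))"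
    "j < dim_col (transpose_mat ?L * (?L * Q * transpose_mat ?L))"
  then have ij: "i < n" "j < r" by auto
  have "(transpose_mat ?L * (?L * Q * transpose_mat ?L)) $$ (i, j)
    = (\<Sum>l = 0..<r. (if l = i then 1 else 0) * Q $$ (l, j))"
    unfolding lead_congruence[OF Q r] using ij by (simp add: scalar_prod_def lead_def)
  also have "\<dots> = Q $$ (i, j)"
  proof (cases "i < r")
    case True
    then show ?thesis by (subst sum.remove[of _ i]) auto
  next
    case False
    then have "Q $$ (i, j) = 0" using ij diag Q r by (auto simp: diagonal_mat_def)
    moreover have "(\<Sum>l = 0..<r. (if l = i then 1 else 0) * Q $$ (l, j)) = 0"
      using False by (intro sum.neutral) auto
    ultimately show ?thesis by simp
  qed
  finally show "(Q * transpose_mat ?L) $$ (i, j)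
      = (transpose_mat ?L * (?L * Q * transpose_mat ?L)) $$ (i, j)"
    using ij mult_lead[OF Q r] by simp
qed (use Q in auto)

text \<open>Right multiplication by a diagonal matrix scales columns. The diagonal entries of the
  identity force every \<open>\<sigma> j\<close> to be nonzero, and then the off-diagonal entries
  force those of \<open>M\<close> to vanish.\<close>

lemma diagonal_mat_left_inverse:
  fixes M :: "'a :: field mat"
  assumes M: "M \<in> carrier_mat n n" and inv: "M * mat_diag n \<sigma> = 1\<^sub>m n"
  shows "diagonal_mat M"
  unfolding diagonal_mat_def
proof (intro allI impI)
  fix i j assume "i < dim_row M" "j < dim_col M" "i \<noteq> j"
  then have ij: "i < n" "j < n" "i \<noteq> j" using M by auto
  have *: "M $$ (k, l) * \<sigma> l = (if k = l then 1 else 0)" if "k < n" "l < n" for k l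
    using arg_cong[OF inv, of "\<lambda>N. N $$ (k, l)"] that mat_diag_mult_right[OF M] by simp
  have "\<sigma> j \<noteq> 0" using *[of j j] ij by auto
  then show "M $$ (i, j) = 0" using *[of i j] ij by simp
qed

section \<open>Balanced coordinates and the reduced model\<close>

theorem theorem4:
  fixes n m r :: nat
    and J R Q A B C Pc Pf T Jb Rb Qb Bb Ab Cb :: "real mat"
  assumes "skew_symmetric n J" and "pos_semidef n R" and "pos_def n Q"
    and "B \<in> carrier_mat n m"
    and "A = (J - R) * Q" and "C = transpose_mat B * Q"
    and "controllable n m A B" and "observable n m A C"
    and "r < n"
    and "stabilizing_control n A B C Pc"
    and "stabilizing_filter n A B C R Pf"
    and "balancing n Pc Pf T"
    and "Jb = T * J * transpose_mat T"
    and "Rb = T * R * transpose_mat T"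
    and "Qb = transpose_mat (inv_mat T) * Q * inv_mat T"
    and "Bb = T * B"
    and "Ab = (Jb - Rb) * Qb" and "Cb = transpose_mat Bb * Qb"
  shows "port_hamiltonian r m (effort_constraint r Jb Rb Qb Bb) \<and>
         effort_constraint r Jb Rb Qb Bb = truncation r (Ab, Bb, Cb)"
proof -
  define Ti where "Ti = inv_mat T"
  define L where "L = lead r n"
  obtain \<sigma> where Tc: "T \<in> carrier_mat n n" and Tinv: "invertible_mat T"
    and bal: "T * Pf * transpose_mat T = mat_diag n \<sigma>"
    using \<open>balancing n Pc Pf T\<close> by (auto simp: balancing_def)
  from inv_mat[OF Tc invertible_mat_det_nonzero[OF Tc Tinv]]
  have Tic: "Ti \<in> carrier_mat n n" and TTi: "T * Ti = 1\<^sub>m n" and TiT: "Ti * T = 1\<^sub>m n"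
    by (auto simp: Ti_def)
  have Jc: "J \<in> carrier_mat n n" and Rc: "R \<in> carrier_mat n n"
    and Qc: "Q \<in> carrier_mat n n" and Bc: "B \<in> carrier_mat n m" and r: "r \<le> n"
    using assms(1-4,9) by (auto simp: skew_symmetric_def pos_semidef_def pos_def_def)
  have Lc: "L \<in> carrier_mat r n" by (simp add: L_def)
  have c: "Jb \<in> carrier_mat n n" "Rb \<in> carrier_mat n n" "Qb \<in> carrier_mat n n"
    "Bb \<in> carrier_mat n m"
    using Tc Tic Jc Rc Qc Bc assms(13-16) by (auto simp: Ti_def)
  \<comment> \<open>Written as a congruence by the transpose of \<open>Ti\<close>, so that positive
    definiteness transfers from \<open>Q\<close>.\<close>
  have Qb: "Qb = transpose_mat Ti * Q * transpose_mat (transpose_mat Ti)"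
    using assms(15) by (simp add: Ti_def)
  have "transpose_mat Ti * transpose_mat T = 1\<^sub>m n"
    using transpose_mult[OF Tc Tic] TTi by simp
  then have "pos_def n Qb"
    unfolding Qb using Tc Tic
    by (intro pos_def_congruence_right_inverse[OF assms(3), of _ _ "transpose_mat T"]) auto
  have Pf: "Pf = inv_mat Q"
    using stabilizing_filter_eq_inverse[OF assms(1-4)] assms(5,6,11) by simp
  have Pfc: "Pf \<in> carrier_mat n n" and QPf: "Q * Pf = 1\<^sub>m n"
    using inv_mat[OF Qc pos_def_det_nonzero[OF assms(3)]] by (auto simp: Pf)
  \<comment> \<open>The balanced Gramian is \<open>T * Pf * transpose_mat T\<close> with
    \<open>Pf = Q^-1\<close>, so the product telescopes to the identity.\<close>
  have "Qb * mat_diag n \<sigma> = transpose_mat Ti * (Q * ((Ti * T) * (Pf * transpose_mat T)))"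
    unfolding Qb bal[symmetric] using Tc Tic Qc Pfc
    by (simp add: assoc_mult_mat[of _ n n _ n _ n])
  also have "\<dots> = transpose_mat Ti * ((Q * Pf) * transpose_mat T)"
    using TiT Tc Tic Qc Pfc by (simp add: assoc_mult_mat[of _ n n _ n _ n])
  also have "\<dots> = 1\<^sub>m n"
    using QPf Tc \<open>transpose_mat Ti * transpose_mat T = 1\<^sub>m n\<close> by simp
  finally have diag: "diagonal_mat Qb"
    using diagonal_mat_left_inverse[OF c(3)] by blast

  \<comment> \<open>Compression to the leading block\<close>
  define Qr where "Qr = L * Qb * transpose_mat L"
  have Qrc: "Qr \<in> carrier_mat r r" using Lc c by (simp add: Qr_def)
  have QL: "Qb * transpose_mat L = transpose_mat L * Qr"
    using diagonal_mult_lead[OF c(3) r diag] by (simp add: L_def Qr_def)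
  have JR: "L * Jb * transpose_mat L - L * Rb * transpose_mat L = L * (Jb - Rb) * transpose_mat L"
    using Lc c by (simp add: mult_minus_distrib_mat[of _ r n] minus_mult_distrib_mat[of _ r n])
  have ec: "effort_constraint r Jb Rb Qb Bb = ((L * Jb * transpose_mat L - L * Rb * transpose_mat L) * Qr,
      L * Bb, transpose_mat (L * Bb) * Qr)"
    using effort_constraint_diagonal[OF c r diag] by (simp add: L_def Qr_def Let_def)
  \<comment> \<open>This right inverse of \<open>L\<close> is what carries positive definiteness
    from \<open>Qb\<close> to \<open>Qr\<close>.\<close>
  have LL: "L * transpose_mat L = 1\<^sub>m r"
    unfolding L_def using lead_mult[of "transpose_mat (lead r n)" n r r] r
    by (auto intro!: eq_matI simp: lead_def)
  have "port_hamiltonian r m (effort_constraint r Jb Rb Qb Bb)"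
  proof -
    have "skew_symmetric r (L * Jb * transpose_mat L)"
      using skew_symmetric_congruence assms(1,13) Tc Lc by blast
    moreover have "pos_semidef r (L * Rb * transpose_mat L)"
      using pos_semidef_congruence assms(2,14) Tc Lc by blast
    moreover have "pos_def r Qr"
      unfolding Qr_def using Lc LL
      by (intro pos_def_congruence_right_inverse[OF \<open>pos_def n Qb\<close>, of _ _ "transpose_mat L"]) auto
    ultimately show ?thesis
      unfolding ec port_hamiltonian_def using Lc c by auto
  qed
  moreover have "truncation r (Ab, Bb, Cb) = effort_constraint r Jb Rb Qb Bb"
  proof -
    have D: "Jb - Rb \<in> carrier_mat n n" using c by (simp add: minus_carrier_mat)
    \<comment> \<open>Moving the transpose of \<open>L\<close> to the left across \<open>Qb\<close>
      leaves \<open>Qr\<close> behind and compresses \<open>Jb - Rb\<close> on both sides; the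
      output matrix is treated alike.\<close>
    have "L * Ab * transpose_mat L = L * (Jb - Rb) * (Qb * transpose_mat L)"
      unfolding assms(17) using D c Lc
      by (simp add: assoc_mult_mat[of _ r n _ n _ n] assoc_mult_mat[of _ r n _ n _ r]
          assoc_mult_mat[of _ n n _ n _ r])
    also have "\<dots> = L * (Jb - Rb) * transpose_mat L * Qr"
      unfolding QL using D Lc Qrc
      by (intro assoc_mult_mat[of _ r n _ r _ r, symmetric]) auto
    finally have 1: "L * Ab * transpose_mat L = L * (Jb - Rb) * transpose_mat L * Qr" .
    have "Cb * transpose_mat L = transpose_mat Bb * (Qb * transpose_mat L)"
      unfolding assms(18) using c Lc by (simp add: assoc_mult_mat[of _ m n _ n _ r])
    also have "\<dots> = transpose_mat (L * Bb) * Qr"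
      unfolding QL using c Lc Qrc transpose_mult[OF Lc c(4)]
      by (simp add: assoc_mult_mat[of _ m n _ r _ r])
    finally have 2: "Cb * transpose_mat L = transpose_mat (L * Bb) * Qr" .
    have "Ab \<in> carrier_mat n n" "Cb \<in> carrier_mat m n" using D c by (auto simp: assms(17,18))
    then show ?thesis
      using truncation_lead[of Ab n Bb m Cb r] c(4) r 1 2 ec JR by (simp add: L_def)
  qed
  ultimately show ?thesis by simp
qed

end
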